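(* Let $I\subseteq\mathbb{R}$ be an interval with interior $I^{\circ}$, let $f:I\to\mathbb{R}$ be differentiable on $I^{\circ}$, let $a,b\in I^{\circ}$ with $0\le a<b$, and suppose $f'\in L[a,b]$. Let $\alpha>0$ and $q>1$. If $|f'|^{q}$ is convex on $[a,b]$ and $g:[a,b]\to\mathbb{R}$ is continuous and symmetric to $(a+b)/2$, then $$\left|\left(\frac{f(a)+f(b)}{2}\right)\left[J_{a+}^{\alpha}g(b)+J_{b-}^{\alpha}g(a)\right]-\left[J_{a+}^{\alpha}(fg)(b)+J_{b-}^{\alpha}(fg)(a)\right]\right|\le \frac{2(b-a)^{\alpha+1}\|g\|_{\infty}}{(\alpha+1)\Gamma(\alpha+1)}\left(1-\frac{1}{2^{\alpha}}\right)\left(\frac{|f'(a)|^{q}+|f'(b)|^{q}}{2}\right)^{1/q}.$$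
   Context: $L[a,b]$ denotes the space of Lebesgue integrable functions on $[a,b]$. For $h\in L[a,b]$ and $\alpha>0$, the Riemann-Liouville fractional integrals of order $\alpha$ are $$J_{a+}^{\alpha}h(x)=\frac{1}{\Gamma(\alpha)}\int_a^x (x-t)^{\alpha-1}h(t)\,dt\quad (x>a),\qquad J_{b-}^{\alpha}h(x)=\frac{1}{\Gamma(\alpha)}\int_x^b (t-x)^{\alpha-1}h(t)\,dt\quad (x<b),$$ where $\Gamma(\alpha)=\int_0^\infty e^{-t}t^{\alpha-1}\,dt$. In particular $J_{a+}^{\alpha}h(b)=\frac{1}{\Gamma(\alpha)}\int_a^b (b-t)^{\alpha-1}h(t)\,dt$ and $J_{b-}^{\alpha}h(a)=\frac{1}{\Gamma(\alpha)}\int_a^b (t-a)^{\alpha-1}h(t)\,dt$. "$g$ is symmetric to $(a+b)/2$" means $g(a+b-x)=g(x)$ for all $x\in[a,b]$. $fg$ denotes the pointwise product on $[a,b]$, and $\|g\|_{\infty}=\sup_{x\in[a,b]}|g(x)|$. *)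

theory Defs
  imports "HOL-Analysis.Analysis"
begin

text \<open>Left- and right-sided Riemann--Liouville fractional integrals \<open>J\<^sub>a\<^sub>+\<^sup>\<alpha> h(x)\<close> (for \<open>x > a\<close>)
  and \<open>J\<^sub>b\<^sub>-\<^sup>\<alpha> h(x)\<close> (for \<open>x < b\<close>), meant for \<open>\<alpha> > 0\<close>. The endpoint where the
  kernel has base \<open>0\<close> (and \<open>0 powr _ = 0\<close>) is a null set.\<close>

definition RL_left :: "real \<Rightarrow> real \<Rightarrow> (real \<Rightarrow> real) \<Rightarrow> real \<Rightarrow> real" where
  "RL_left a \<alpha> h x =
     1 / Gamma \<alpha> * set_lebesgue_integral lebesgue {a..x} (\<lambda>t. (x - t) powr (\<alpha> - 1) * h t)"

definition RL_right :: "real \<Rightarrow> real \<Rightarrow> (real \<Rightarrow> real) \<Rightarrow> real \<Rightarrow> real" where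
  "RL_right b \<alpha> h x =
     1 / Gamma \<alpha> * set_lebesgue_integral lebesgue {x..b} (\<lambda>t. (t - x) powr (\<alpha> - 1) * h t)"

end

theory Submission
  imports Defs
begin

text \<open>The weight \<open>k t = (b - t) powr (\<alpha> - 1) + (t - a) powr (\<alpha> - 1)\<close> and \<open>g\<close> are both symmetric about
  the midpoint, so the integral of \<open>k g ((f a + f b) / 2 - f)\<close> folds to the integral of
  \<open>k(t) g(t) (f a + f b - f t - f (a + b - t))\<close> over the left half of the interval.
  The function \<open>f t + f (a + b - t)\<close> has derivative \<open>f' t - f' (a + b - t)\<close>, which by the power
  mean inequality and convexity of \<open>\<bar>f'\<bar> powr q\<close> is at most twice
  \<open>M = ((\<bar>f' a\<bar> powr q + \<bar>f' b\<bar> powr q) / 2) powr (1 / q)\<close>; the last factor is therefore at most \<open>2 M (t - a)\<close>.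
  Integrating \<open>k(t) (t - a)\<close> over the left half gives exactly the constant claimed.\<close>

text \<open>Midpoint convexity of \<open>powr q\<close>: the power mean inequality that turns a
  bound on q-th powers into a bound on a sum of absolute values.\<close>

lemma powr_midpoint_le:
  fixes x y q :: real
  assumes "0 \<le> x" "0 \<le> y" "1 \<le> q"
  shows "((x + y) / 2) powr q \<le> (x powr q + y powr q) / 2"
\<comment> \<open>\<open>powr_convex\<close> speaks of the open half-line only; if an argument is 0,
  the claim reduces to (1/2) powr q \<le> 1/2.\<close>
proof (cases "x = 0 \<or> y = 0")
  case True
  have "(1/2) powr q \<le> (1/2::real) powr 1"
    using assms by (intro powr_mono') auto
  then have "(z / 2) powr q \<le> z powr q / 2" if "0 \<le> z" for z :: real
    using mult_left_mono[of "(1/2) powr q" "1/2" "z powr q"] that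
    by (simp add: powr_mult[symmetric])
  then show ?thesis
    using True assms by auto
next
  case False
  then have "x \<in> {0<..}" "y \<in> {0<..}"
    using assms by auto
  then show ?thesis
    using convex_onD[OF powr_convex[OF \<open>1 \<le> q\<close>], of "1/2" x y] by (simp add: field_simps)
qed

text \<open>A point and its reflection are convex combinations of \<open>a\<close> and
  \<open>b\<close> with the weights \<open>1 - u\<close> and \<open>u\<close> exchanged, so the
  weights add up to 1 at each endpoint.\<close>

lemma convex_on_reflect_sum_le:
  fixes \<phi> :: "real \<Rightarrow> real"
  assumes "convex_on {a..b} \<phi>" "x \<in> {a..b}" "a < b"
  shows "\<phi> x + \<phi> (a + b - x) \<le> \<phi> a + \<phi> b"
proof -
  define u where "u = (x - a) / (b - a)"
  have u: "0 \<le> u" "u \<le> 1" and ux: "u * (b - a) = x - a"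
    using assms by (auto simp: u_def)
  have x: "(1 - u) *\<^sub>R a + u *\<^sub>R b = x" "(1 - (1 - u)) *\<^sub>R a + (1 - u) *\<^sub>R b = a + b - x"
    using ux by (simp_all add: algebra_simps)
  have "\<phi> x \<le> (1 - u) * \<phi> a + u * \<phi> b" "\<phi> (a + b - x) \<le> (1 - (1 - u)) * \<phi> a + (1 - u) * \<phi> b"
    using convex_onD[OF assms(1), of u a b] convex_onD[OF assms(1), of "1 - u" a b] u assms(3)
    unfolding x by auto
  then show ?thesis
    by (simp add: algebra_simps)
qed

lemma has_integral_reflect_at:
  fixes \<phi> :: "real \<Rightarrow> real"
  assumes "(\<phi> has_integral i) {c..d}"
  shows "((\<lambda>t. \<phi> (s - t)) has_integral i) {s - d..s - c}"
proof -
  \<comment> \<open>This is the image of the interval under the inverse of t -> s - t, written as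
    \<open>has_integral_affinity\<close> produces it for the factor -1.\<close>
  have "(\<lambda>x. (1 / (-1)) *\<^sub>R x + - ((1 / (-1)) *\<^sub>R s)) ` cbox c d = {s - d..s - c}"
    using image_diff_atLeastAtMost[of s c d] by (simp add: image_def)
  then show ?thesis
    using has_integral_affinity[of \<phi> i c d "-1" s] assms by simp
qed

lemma integral_fold_midpoint:
  fixes \<psi> :: "real \<Rightarrow> real"
  assumes "\<psi> integrable_on {a..b}" "a \<le> b"
  shows "((\<lambda>t. \<psi> t + \<psi> (a + b - t)) has_integral integral {a..b} \<psi>) {a..(a + b) / 2}"
proof -
  have "\<psi> integrable_on {a..(a + b) / 2}" "\<psi> integrable_on {(a + b) / 2..b}"
    using assms by (auto intro!: integrable_subinterval_real[OF assms(1)])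
  then have L: "(\<psi> has_integral integral {a..(a + b) / 2} \<psi>) {a..(a + b) / 2}"
    and R: "((\<lambda>t. \<psi> (a + b - t)) has_integral integral {(a + b) / 2..b} \<psi>) {a..(a + b) / 2}"
    using has_integral_reflect_at[of \<psi> _ "(a + b) / 2" b "a + b"]
    by (auto simp: integrable_integral field_simps)
  have "integral {a..b} \<psi> = integral {a..(a + b) / 2} \<psi> + integral {(a + b) / 2..b} \<psi>"
    using assms by (intro Henstock_Kurzweil_Integration.integral_combine[symmetric]) auto
  then show ?thesis
    using has_integral_add[OF L R] by simp
qed

lemma has_integral_left_kernel:
  fixes a x \<alpha> :: real
  assumes "a \<le> x" "0 < \<alpha>"
  shows "((\<lambda>t. (t - a) powr (\<alpha> - 1)) has_integral (x - a) powr \<alpha> / \<alpha>) {a..x}"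
proof -
  have "((\<lambda>t. t powr (\<alpha> - 1)) has_integral (x - a) powr \<alpha> / \<alpha>) (cbox 0 (x - a))"
    using has_integral_powr_from_0[of "\<alpha> - 1" "x - a"] assms by simp
  from has_integral_affinity'[OF this, of 1 "-a"] show ?thesis
    by simp
qed

text \<open>The fractional integrals are Lebesgue integrals; absolute integrability is what allows
  passing to the gauge integral, where folding and the fundamental theorem are carried out.\<close>

lemma absolutely_integrable_kernel_times_continuous:
  fixes a b \<alpha> :: real
  assumes "a \<le> b" "0 < \<alpha>" "continuous_on {a..b} h"
  shows "(\<lambda>t. (t - a) powr (\<alpha> - 1) * h t) absolutely_integrable_on {a..b}"
    and "(\<lambda>t. (b - t) powr (\<alpha> - 1) * h t) absolutely_integrable_on {a..b}"
proof -
  have h: "h \<in> borel_measurable (lebesgue_on {a..b})" "bounded (h ` {a..b})"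
    using assms
    by (auto intro: continuous_imp_measurable_on_sets_lebesgue compact_imp_bounded compact_continuous_image)
  \<comment> \<open>For \<alpha> < 1 the kernel is unbounded near an endpoint. Being nonnegative and
    integrable it is absolutely integrable, and a bounded measurable factor preserves this.\<close>
  have *: "(\<lambda>t. k t * h t) absolutely_integrable_on {a..b}"
    if "k integrable_on {a..b}" "\<And>t. 0 \<le> k t" for k :: "real \<Rightarrow> real"
    using absolutely_integrable_bounded_measurable_product_real[OF h(1) _ h(2), of k]
      nonnegative_absolutely_integrable_1[OF that(1)] that(2) by (simp add: mult.commute)
  note k = has_integral_left_kernel[OF assms(1,2)]
  show "(\<lambda>t. (t - a) powr (\<alpha> - 1) * h t) absolutely_integrable_on {a..b}"
    using k by (intro *) (auto simp: integrable_on_def)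
  have "((\<lambda>t. (b - t) powr (\<alpha> - 1)) has_integral (b - a) powr \<alpha> / \<alpha>) {a..b}"
    using has_integral_reflect_at[OF k, of "a + b"] by simp
  then show "(\<lambda>t. (b - t) powr (\<alpha> - 1) * h t) absolutely_integrable_on {a..b}"
    by (intro *) (auto simp: integrable_on_def)
qed

text \<open>Both integrals run over all of \<open>{a..b}\<close>, so they merge into one with the
  symmetric weight; the factor \<open>Gamma \<alpha>\<close> clears the normalisation.\<close>

lemma RL_left_plus_RL_right:
  fixes a b \<alpha> :: real
  assumes "a \<le> b" "0 < \<alpha>" "continuous_on {a..b} h"
  shows "((\<lambda>t. ((b - t) powr (\<alpha> - 1) + (t - a) powr (\<alpha> - 1)) * h t)
    has_integral Gamma \<alpha> * (RL_left a \<alpha> h b + RL_right b \<alpha> h a)) {a..b}"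
proof -
  note ai = absolutely_integrable_kernel_times_continuous[OF assms]
  have "Gamma \<alpha> > 0"
    using assms by simp
  then have "Gamma \<alpha> * (RL_left a \<alpha> h b + RL_right b \<alpha> h a)
    = integral {a..b} (\<lambda>t. (b - t) powr (\<alpha> - 1) * h t)
      + integral {a..b} (\<lambda>t. (t - a) powr (\<alpha> - 1) * h t)"
    unfolding RL_left_def RL_right_def
    by (simp add: set_lebesgue_integral_eq_integral(2)[OF ai(1)]
        set_lebesgue_integral_eq_integral(2)[OF ai(2)] distrib_left)
  moreover have "((\<lambda>t. (b - t) powr (\<alpha> - 1) * h t + (t - a) powr (\<alpha> - 1) * h t) has_integral
      integral {a..b} (\<lambda>t. (b - t) powr (\<alpha> - 1) * h t)
      + integral {a..b} (\<lambda>t. (t - a) powr (\<alpha> - 1) * h t)) {a..b}"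
    using set_lebesgue_integral_eq_integral(1)[OF ai(1)]
      set_lebesgue_integral_eq_integral(1)[OF ai(2)]
    by (intro has_integral_add integrable_integral)
  ultimately show ?thesis
    by (simp add: distrib_right)
qed

lemma has_integral_half_kernel_moment:
  fixes a b \<alpha> :: real
  assumes "a < b" "0 < \<alpha>"
  shows "((\<lambda>t. ((b - t) powr (\<alpha> - 1) + (t - a) powr (\<alpha> - 1)) * (t - a)) has_integral
    (b - a) powr (\<alpha> + 1) * (1 - 1 / 2 powr \<alpha>) / (\<alpha> * (\<alpha> + 1))) {a..(a + b) / 2}"
proof -
  \<comment> \<open>An antiderivative, found by writing t - a = (b - a) - (b - t) in the summand
    with base b - t.\<close>
  define F where "F = (\<lambda>t. (b - t) powr (\<alpha> + 1) / (\<alpha> + 1) - (b - a) * (b - t) powr \<alpha> / \<alpha>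
    + (t - a) powr (\<alpha> + 1) / (\<alpha> + 1))"
  let ?k = "\<lambda>t. ((b - t) powr (\<alpha> - 1) + (t - a) powr (\<alpha> - 1)) * (t - a)"
  have cont: "continuous_on {a..(a + b) / 2} F"
    unfolding F_def using assms by (intro continuous_on_powr' continuous_intros) auto
  have deriv: "(F has_vector_derivative ?k t) (at t)" if t: "t \<in> {a<..<(a + b) / 2}" for t
  proof -
    have pos: "0 < b - t" "0 < t - a"
      using t assms by auto
    have "(F has_real_derivative (b - a) * (b - t) powr (\<alpha> - 1) - (b - t) powr \<alpha> + (t - a) powr \<alpha>) (at t)"
      unfolding F_def
      by (rule derivative_eq_intros refl | use pos assms in simp)+
    moreover have "(b - t) powr \<alpha> = (b - t) powr (\<alpha> - 1) * (b - t)"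
      "(t - a) powr \<alpha> = (t - a) powr (\<alpha> - 1) * (t - a)"
      using pos by (simp_all add: powr_mult_base' mult.commute powr_diff)
    ultimately show ?thesis
      by (simp add: has_real_derivative_iff_has_vector_derivative algebra_simps)
  qed
  \<comment> \<open>At the midpoint both bases equal (b - a) / 2, so the two terms of exponent
    \<alpha> + 1 coincide; the factor 1/\<alpha> - 1/(\<alpha> + 1) can then be taken out.\<close>
  have eq: "F ((a + b) / 2) - F a = (b - a) powr (\<alpha> + 1) * (1 - 1 / 2 powr \<alpha>) / (\<alpha> * (\<alpha> + 1))"
  proof -
    define P where "P = (b - a) powr \<alpha>"
    define p where "p = 2 powr \<alpha>"
    have half: "b - (a + b) / 2 = (b - a) / 2" "(a + b) / 2 - a = (b - a) / 2"
      by (simp_all add: field_simps)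
    have pw: "(b - a) powr (\<alpha> + 1) = P * (b - a)" "((b - a) / 2) powr \<alpha> = P / p"
      "((b - a) / 2) powr (\<alpha> + 1) = P * (b - a) / (2 * p)"
      using assms by (simp_all add: P_def p_def powr_add powr_divide)
    have "0 < p"
      by (simp add: p_def)
    then show ?thesis
      unfolding F_def half pw p_def[symmetric] P_def[symmetric] using assms
      by (simp add: divide_simps pw) (simp add: algebra_simps)
  qed
  \<comment> \<open>The interior form asks only for continuity at t = a, where the base t - a
    vanishes and the derivative computation above does not apply.\<close>
  have "(?k has_integral (F ((a + b) / 2) - F a)) {a..(a + b) / 2}"
    using assms by (intro fundamental_theorem_of_calculus_interior cont deriv) auto
  then show ?thesis
    unfolding eq .
qed

lemma abs_reflect_defect_le:
  fixes f :: "real \<Rightarrow> real"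
  assumes diff: "\<And>x. x \<in> {a..b} \<Longrightarrow> f differentiable (at x)"
    and "a < b" "1 < q" and conv: "convex_on {a..b} (\<lambda>x. \<bar>deriv f x\<bar> powr q)"
    and t: "t \<in> {a..(a + b) / 2}"
  shows "\<bar>f a + f b - f t - f (a + b - t)\<bar>
    \<le> 2 * ((\<bar>deriv f a\<bar> powr q + \<bar>deriv f b\<bar> powr q) / 2) powr (1 / q) * (t - a)"
proof -
  define M where "M = ((\<bar>deriv f a\<bar> powr q + \<bar>deriv f b\<bar> powr q) / 2) powr (1 / q)"
  define G where "G = (\<lambda>x. f x + f (a + b - x))"
  have D: "(f has_real_derivative deriv f x) (at x)" if "x \<in> {a..b}" for x
    using diff[OF that] by (simp add: DERIV_deriv_iff_real_differentiable)
  have dG: "(G has_real_derivative deriv f x - deriv f (a + b - x)) (at x within {a..b})"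
    if "x \<in> {a..b}" for x
  proof -
    have "((\<lambda>x. f (a + b - x)) has_real_derivative deriv f (a + b - x) * (0 - 1)) (at x)"
    proof (rule DERIV_chain2[where f = f])
      show "(f has_real_derivative deriv f (a + b - x)) (at (a + b - x))"
        using that by (intro D) auto
      show "((\<lambda>x. a + b - x) has_real_derivative 0 - 1) (at x)"
        by (intro derivative_intros)
    qed
    then have "(G has_real_derivative deriv f x - deriv f (a + b - x)) (at x)"
      using DERIV_add[OF D[OF that]] by (fastforce simp: G_def)
    then show ?thesis
      by (rule has_field_derivative_at_within)
  qed
  have bound: "norm (deriv f x - deriv f (a + b - x)) \<le> 2 * M" if x: "x \<in> {a..b}" for x
  proof -
    let ?u = "\<bar>deriv f x\<bar>" and ?v = "\<bar>deriv f (a + b - x)\<bar>"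
    have "((?u + ?v) / 2) powr q \<le> (?u powr q + ?v powr q) / 2"
      using \<open>1 < q\<close> by (intro powr_midpoint_le) auto
    also have "\<dots> \<le> (\<bar>deriv f a\<bar> powr q + \<bar>deriv f b\<bar> powr q) / 2"
      using convex_on_reflect_sum_le[OF conv x \<open>a < b\<close>] by simp
    finally have "(((?u + ?v) / 2) powr q) powr (1 / q) \<le> M"
      unfolding M_def using \<open>1 < q\<close> by (intro powr_mono2) auto
    then have "?u + ?v \<le> 2 * M"
      using \<open>1 < q\<close> by (simp add: powr_powr)
    then show ?thesis
      by simp
  qed
  \<comment> \<open>Mean value inequality for \<open>G\<close> between a and t; here G a = f a + f
    b.\<close>
  have "norm (G a - G t) \<le> 2 * M * norm (a - t)"
    by (rule field_differentiable_bound[of "{a..b}", OF _ dG bound]) (use t \<open>a < b\<close> in auto)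
  then show ?thesis
    using t by (simp add: G_def M_def algebra_simps)
qed

theorem theorem6:
  fixes I :: "real set" and f g :: "real \<Rightarrow> real" and a b \<alpha> q :: real
  assumes "is_interval I"
    and "\<And>x. x \<in> interior I \<Longrightarrow> f differentiable (at x)"
    and "a \<in> interior I" and "b \<in> interior I"
    and "0 \<le> a" and "a < b"
    and "deriv f absolutely_integrable_on {a..b}"
    and "\<alpha> > 0" and "q > 1"
    and "convex_on {a..b} (\<lambda>x. \<bar>deriv f x\<bar> powr q)"
    and "continuous_on {a..b} g"
    and "\<And>x. x \<in> {a..b} \<Longrightarrow> g (a + b - x) = g x"
  shows "\<bar>(f a + f b) / 2 * (RL_left a \<alpha> g b + RL_right b \<alpha> g a)
           - (RL_left a \<alpha> (\<lambda>x. f x * g x) b + RL_right b \<alpha> (\<lambda>x. f x * g x) a)\<bar>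
         \<le> 2 * (b - a) powr (\<alpha> + 1) * (SUP x\<in>{a..b}. \<bar>g x\<bar>) / ((\<alpha> + 1) * Gamma (\<alpha> + 1))
           * (1 - 1 / 2 powr \<alpha>)
           * ((\<bar>deriv f a\<bar> powr q + \<bar>deriv f b\<bar> powr q) / 2) powr (1 / q)"
proof -
  define k where "k = (\<lambda>t. (b - t) powr (\<alpha> - 1) + (t - a) powr (\<alpha> - 1))"
  define N where "N = (SUP x\<in>{a..b}. \<bar>g x\<bar>)"
  define M where "M = ((\<bar>deriv f a\<bar> powr q + \<bar>deriv f b\<bar> powr q) / 2) powr (1 / q)"
  define c where "c = (f a + f b) / 2"
  define E where "E = c * (RL_left a \<alpha> g b + RL_right b \<alpha> g a)
    - (RL_left a \<alpha> (\<lambda>x. f x * g x) b + RL_right b \<alpha> (\<lambda>x. f x * g x) a)"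
  define K where "K = (b - a) powr (\<alpha> + 1) * (1 - 1 / 2 powr \<alpha>) / (\<alpha> * (\<alpha> + 1))"
  let ?m = "(a + b) / 2"
  \<comment> \<open>Convexity puts the whole segment inside the interior, so \<open>f\<close> has
    two-sided derivatives even at \<open>a\<close> and \<open>b\<close>.\<close>
  have "convex (interior I)"
    using assms(1) by (simp add: is_interval_convex)
  then have sub: "{a..b} \<subseteq> interior I"
    using assms(3,4) closed_segment_subset[of a "interior I" b] assms(6)
    by (simp add: closed_segment_eq_real_ivl)
  then have diff: "f differentiable (at x)" if "x \<in> {a..b}" for x
    using that assms(2) by blast
  then have contf: "continuous_on {a..b} f"
    by (meson continuous_at_imp_continuous_on differentiable_imp_continuous_within)
  \<comment> \<open>A real \<open>SUP\<close> is an upper bound only for a set bounded above;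
    compactness supplies this.\<close>
  have "bdd_above ((\<lambda>x. \<bar>g x\<bar>) ` {a..b})"
    using assms(11) by (intro bounded_imp_bdd_above compact_imp_bounded compact_continuous_image
        continuous_intros) auto
  then have N: "\<bar>g x\<bar> \<le> N" if "x \<in> {a..b}" for x
    unfolding N_def using that by (intro cSUP_upper)
  have "((\<lambda>t. c * (k t * g t) - k t * (f t * g t)) has_integral
      c * (Gamma \<alpha> * (RL_left a \<alpha> g b + RL_right b \<alpha> g a))
      - Gamma \<alpha> * (RL_left a \<alpha> (\<lambda>x. f x * g x) b + RL_right b \<alpha> (\<lambda>x. f x * g x) a)) {a..b}"
    unfolding k_def using assms(6,8,11) contf
    by (intro has_integral_diff has_integral_mult_right RL_left_plus_RL_right continuous_intros) auto
  then have full: "((\<lambda>t. k t * g t * (c - f t)) has_integral Gamma \<alpha> * E) {a..b}"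
    by (simp add: E_def algebra_simps)
  have "((\<lambda>t. k t * g t * (c - f t) + k (a + b - t) * g (a + b - t) * (c - f (a + b - t)))
      has_integral Gamma \<alpha> * E) {a..?m}"
    using integral_fold_midpoint[of "\<lambda>t. k t * g t * (c - f t)" a b] full assms(6)
    by (auto simp: integrable_on_def integral_unique)
  \<comment> \<open>Reflection swaps the two summands of \<open>k\<close> and fixes
    \<open>g\<close>, so \<open>k t * g t\<close> factors out, and the two copies of
    \<open>c\<close> add up to f a + f b.\<close>
  then have fold: "((\<lambda>t. k t * g t * (f a + f b - f t - f (a + b - t))) has_integral Gamma \<alpha> * E) {a..?m}"
  proof (rule has_integral_eq[rotated])
    fix t assume "t \<in> {a..?m}"
    then have "t \<in> {a..b}"
      using assms(6) by auto
    then have "g (a + b - t) = g t" "k (a + b - t) = k t"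
      using assms(12) by (simp_all add: k_def)
    then show "k t * g t * (c - f t) + k (a + b - t) * g (a + b - t) * (c - f (a + b - t))
        = k t * g t * (f a + f b - f t - f (a + b - t))"
      by (simp add: c_def field_simps)
  qed
  have major: "((\<lambda>t. 2 * M * N * (k t * (t - a))) has_integral 2 * M * N * K) {a..?m}"
    unfolding k_def K_def
    using has_integral_half_kernel_moment[OF assms(6,8)] by (rule has_integral_mult_right)
  have le: "norm (k t * g t * (f a + f b - f t - f (a + b - t))) \<le> 2 * M * N * (k t * (t - a))"
    if t: "t \<in> {a..?m}" for t
  proof -
    have tab: "t \<in> {a..b}"
      using t assms(6) by auto
    have "0 \<le> N"
      using N[OF tab] by linarith
    have "\<bar>g t\<bar> * \<bar>f a + f b - f t - f (a + b - t)\<bar> \<le> N * (2 * M * (t - a))"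
      unfolding M_def using N[OF tab] \<open>0 \<le> N\<close> abs_reflect_defect_le[OF diff assms(6,9,10) t]
      by (intro mult_mono) auto
    then have "k t * (\<bar>g t\<bar> * \<bar>f a + f b - f t - f (a + b - t)\<bar>) \<le> k t * (N * (2 * M * (t - a)))"
      by (intro mult_left_mono) (auto simp: k_def)
    moreover have "\<bar>k t\<bar> = k t"
      by (simp add: k_def)
    ultimately show ?thesis
      by (simp add: abs_mult mult_ac)
  qed
  have "norm (Gamma \<alpha> * E) \<le> 2 * M * N * K"
    using integral_norm_bound_integral[OF has_integral_integrable[OF fold]
        has_integral_integrable[OF major] le]
    unfolding integral_unique[OF fold] integral_unique[OF major] .
  then have "Gamma \<alpha> * \<bar>E\<bar> \<le> 2 * M * N * K"
    using assms(8) by (simp add: abs_mult)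
  then have "\<bar>E\<bar> \<le> 2 * M * N * K / Gamma \<alpha>"
    using assms(8) by (simp add: field_simps)
  \<comment> \<open>The factor \<alpha> in the denominator of \<open>K\<close> is absorbed here,
    giving the constant in the claimed form.\<close>
  also have "Gamma (\<alpha> + 1) = \<alpha> * Gamma \<alpha>"
    using assms(8) by (intro Gamma_plus1) (auto simp: nonpos_Ints_def)
  then have "2 * M * N * K / Gamma \<alpha>
      = 2 * (b - a) powr (\<alpha> + 1) * N / ((\<alpha> + 1) * Gamma (\<alpha> + 1)) * (1 - 1 / 2 powr \<alpha>) * M"
    by (simp add: K_def mult_ac)
  finally show ?thesis
    unfolding E_def c_def N_def M_def .
qed

end
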